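(* Let $E$ be a nonzero real Banach space and $f\colon E\to\,]{-}\infty,\infty]$ be proper, convex and lower semicontinuous. Then $(\partial f)^{\mathbb F}=\partial(f^* )$, i.e. for all $(y^*,y^{**})\in E^*\times E^{**}$, $(y^*,y^{**})\in G((\partial f)^{\mathbb F})$ if and only if $f^*(y^* )+f^{**}(y^{**})=\langle y^*,y^{**}\rangle$.
   Context: $E^*$, $E^{**}$ are the dual and bidual, with pairings $\langle x,x^*\rangle$ and $\langle x^*,x^{**}\rangle$. $f^*(x^* )=\sup_{x\in E}[\langle x,x^*\rangle-f(x)]$, $f^{**}(x^{**})=\sup_{x^*\in E^*}[\langle x^*,x^{**}\rangle-f^*(x^* )]$; $x^*\in\partial f(x)$ iff $f(x)+f^*(x^* )=\langle x,x^*\rangle$. (The multifunction $\partial f$ is closed, monotone and quasidense, so its Fitzpatrick extension is defined.) For a multifunction $S\colon E\rightrightarrows E^*$ with nonempty graph $G(S)$: closed means $G(S)$ norm-closed; monotone means $\langle s-t,s^*-t^*\rangle\ge0$ on $G(S)$; quasidense means for every $(x,x^* )\in E\times E^*$, $\inf_{(s,s^* )\in G(S)}[\tfrac12\|s-x\|^2+\tfrac12\|s^*-x^*\|^2+\langle s-x,s^*-x^*\rangle]\le0$. Define $\varphi_S(x,x^* )=\sup_{(s,s^* )\in G(S)}[\langle s,x^*\rangle+\langle x,s^*\rangle-\langle s,s^*\rangle]$ on $E\times E^*$; identify $(E\times E^* )^*$ with $E^*\times E^{**}$ via $\langle (x,x^* ),(y^*,y^{**})\rangle=\langle x,y^*\rangle+\langle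 x^*,y^{**}\rangle$, and let $\varphi_S^*$ be the conjugate on $E^*\times E^{**}$. For $S$ closed, monotone and quasidense, one has $\varphi_S^*(y^*,y^{**})\ge\langle y^*,y^{**}\rangle$ everywhere, and the Fitzpatrick extension $S^{\mathbb F}\colon E^*\rightrightarrows E^{**}$ is defined by $(y^*,y^{**})\in G(S^{\mathbb F})$ iff $\varphi_S^*(y^*,y^{**})=\langle y^*,y^{**}\rangle$. *)

theory Defs
  imports "HOL-Analysis.Analysis"
begin

(* The dual of a real normed space 'a is modelled by the type 'a =>L real
  of bounded (continuous) linear functionals with the operator norm; the bidual
  is ('a =>L real) =>L real.  The pairing of x with x^ is x^ x.
  Functions into the extended reals use ereal. *)

definition proper_fun :: "('a \<Rightarrow> ereal) \<Rightarrow> bool" where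
  "proper_fun f \<longleftrightarrow> (\<forall>x. f x \<noteq> -\<infinity>) \<and> (\<exists>x. f x \<noteq> \<infinity>)"

definition convex_fun :: "('a::real_vector \<Rightarrow> ereal) \<Rightarrow> bool" where
  "convex_fun f \<longleftrightarrow> (\<forall>x y t. 0 < t \<and> t < 1 \<longrightarrow>
      f (t *\<^sub>R x + (1 - t) *\<^sub>R y) \<le> ereal t * f x + ereal (1 - t) * f y)"

definition lsc_fun :: "('a::topological_space \<Rightarrow> ereal) \<Rightarrow> bool" where
  "lsc_fun f \<longleftrightarrow> (\<forall>c::real. closed {x. f x \<le> ereal c})"

definition fconj :: "('a::real_normed_vector \<Rightarrow> ereal) \<Rightarrow> ('a \<Rightarrow>\<^sub>L real) \<Rightarrow> ereal" where
  "fconj f x' = (SUP x. ereal (blinfun_apply x' x) - f x)"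

definition subdiff_graph :: "('a::real_normed_vector \<Rightarrow> ereal) \<Rightarrow> ('a \<times> ('a \<Rightarrow>\<^sub>L real)) set" where
  "subdiff_graph f = {(x, x'). f x + fconj f x' = ereal (blinfun_apply x' x)}"

definition fitz_fun :: "('a::real_normed_vector \<times> ('a \<Rightarrow>\<^sub>L real)) set \<Rightarrow> 'a \<Rightarrow> ('a \<Rightarrow>\<^sub>L real) \<Rightarrow> ereal" where
  "fitz_fun G x x' = (SUP p\<in>G. ereal (blinfun_apply x' (fst p) + blinfun_apply (snd p) x
                                       - blinfun_apply (snd p) (fst p)))"

(* Conjugate of the Fitzpatrick function on E^ \<times> E^^, with pairing
  <(x,x^),(y^,y^^)> = <x,y^> + <x^,y^^>. *)
definition fitz_conj :: "('a::real_normed_vector \<times> ('a \<Rightarrow>\<^sub>L real)) set \<Rightarrow>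
    ('a \<Rightarrow>\<^sub>L real) \<Rightarrow> (('a \<Rightarrow>\<^sub>L real) \<Rightarrow>\<^sub>L real) \<Rightarrow> ereal" where
  "fitz_conj G y' y'' = (SUP p. ereal (blinfun_apply y' (fst p) + blinfun_apply y'' (snd p))
                                  - fitz_fun G (fst p) (snd p))"

definition fitz_ext_graph :: "('a::real_normed_vector \<times> ('a \<Rightarrow>\<^sub>L real)) set \<Rightarrow>
    (('a \<Rightarrow>\<^sub>L real) \<times> (('a \<Rightarrow>\<^sub>L real) \<Rightarrow>\<^sub>L real)) set" where
  "fitz_ext_graph G = {(y', y''). fitz_conj G y' y'' = ereal (blinfun_apply y'' y')}"

end

theory Submission
  imports Defs
begin

text \<open>
  Write \<open>\<phi>\<close> for the Fitzpatrick function of \<open>\<partial>f\<close>. The Fenchel-Young inequality gives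
  \<open>\<phi>(x,x\<^sup>*) \<le> f(x) + f\<^sup>*(x\<^sup>*)\<close>, hence \<open>\<phi>\<^sup>*(y\<^sup>*,y\<^sup>*\<^sup>*) \<ge> f\<^sup>*(y\<^sup>*) + f\<^sup>*\<^sup>*(y\<^sup>*\<^sup>*) \<ge> \<langle>y\<^sup>*,y\<^sup>*\<^sup>*\<rangle>\<close>, which
  is one implication. Conversely, if \<open>y\<^sup>*\<^sup>*\<close> is a subgradient of \<open>f\<^sup>*\<close> at \<open>y\<^sup>*\<close>, one has to find for all
  \<open>x, x\<^sup>*\<close> points \<open>(s,s\<^sup>*)\<close> of the graph of \<open>\<partial>f\<close> with \<open>\<langle>s-x, s\<^sup>*-x\<^sup>*\<rangle> \<le> \<langle>y\<^sup>*-x\<^sup>*, y\<^sup>*\<^sup>*-x\<rangle> + \<epsilon>\<close>.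
  Put \<open>u = y\<^sup>* - x\<^sup>*\<close>. Ekeland's principle yields an approximate minimiser \<open>s\<close> of
  \<open>f - y\<^sup>* + \<tau> u + \<tau>\<^sup>2/2 \<parallel>\<cdot> - x\<parallel>\<^sup>2\<close>, and a Hahn-Banach sandwich yields \<open>s\<^sup>*\<close> in \<open>\<partial>f(s)\<close> such that
  \<open>w = s\<^sup>* - y\<^sup>* + \<tau> u\<close> is controlled by the quadratic term. Monotonicity of \<open>\<partial>f\<^sup>*\<close> between
  \<open>(s\<^sup>*,s)\<close> and \<open>(y\<^sup>*,y\<^sup>*\<^sup>*)\<close> bounds \<open>\<langle>s-x, u\<rangle>\<close> by \<open>\<langle>u, y\<^sup>*\<^sup>*-x\<rangle> + O(\<tau>)\<close>, and \<open>\<tau> \<rightarrow> 0\<close> gives the claim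
  without any appeal to weak-star density.
\<close>

subsection \<open>The Hahn-Banach theorem\<close>

lemma le_cINF_add_cINF:
  fixes f :: "'a \<Rightarrow> real" and g :: "'b \<Rightarrow> real"
  assumes "A \<noteq> {}" "B \<noteq> {}" "\<And>a b. a \<in> A \<Longrightarrow> b \<in> B \<Longrightarrow> m \<le> f a + g b"
  shows "m \<le> (INF a\<in>A. f a) + (INF b\<in>B. g b)"
proof -
  have "m - g b \<le> (INF a\<in>A. f a)" if "b \<in> B" for b
    by (rule cINF_greatest[OF assms(1)]) (use assms(3)[OF _ that] in \<open>simp add: algebra_simps\<close>)
  then have "m - (INF a\<in>A. f a) \<le> (INF b\<in>B. g b)"
    by (intro cINF_greatest[OF assms(2)]) (simp add: algebra_simps)
  then show ?thesis by simp
qed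

lemma le_mult_cINF:
  fixes f :: "'a \<Rightarrow> real"
  assumes "A \<noteq> {}" "0 < c" "\<And>a. a \<in> A \<Longrightarrow> m \<le> c * f a"
  shows "m \<le> c * (INF a\<in>A. f a)"
proof -
  have "m / c \<le> (INF a\<in>A. f a)"
    by (rule cINF_greatest[OF assms(1)]) (use assms in \<open>simp add: field_simps\<close>)
  then show ?thesis using assms(2) by (simp add: field_simps)
qed

text \<open>Homogeneity is asked only as an inequality for positive factors, which is easy to check
  for infima; the factor \<open>inverse c\<close> turns it into an equality, and
  \<open>c = 2\<close> gives \<open>p 0 = 0\<close>.\<close>

definition sublinear :: "('a::real_vector \<Rightarrow> real) \<Rightarrow> bool" where
  "sublinear p \<longleftrightarrow> (\<forall>x y. p (x + y) \<le> p x + p y) \<and> (\<forall>c x. 0 < c \<longrightarrow> p (c *\<^sub>R x) \<le> c * p x)"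

lemma sublinear_add: "sublinear p \<Longrightarrow> p (x + y) \<le> p x + p y"
  by (simp add: sublinear_def)

lemma sublinear_scaleR:
  assumes "sublinear p" "0 < c"
  shows "p (c *\<^sub>R x) = c * p x"
proof (rule antisym)
  show "p (c *\<^sub>R x) \<le> c * p x" using assms by (simp add: sublinear_def)
  have "p (inverse c *\<^sub>R (c *\<^sub>R x)) \<le> inverse c * p (c *\<^sub>R x)"
    using assms unfolding sublinear_def by (metis inverse_positive_iff_positive)
  then show "c * p x \<le> p (c *\<^sub>R x)" using assms(2) by (simp add: field_simps)
qed

lemma sublinear_0: "sublinear p \<Longrightarrow> p 0 = 0"
  using sublinear_scaleR[of p 2 0] by simp

lemma sublinear_minus: "sublinear p \<Longrightarrow> - p (- x) \<le> p x"
  using sublinear_add[of p x "- x"] sublinear_0[of p] by simp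

text \<open>The pointwise infimum works. It is finite because \<open>g \<le> p\<close> forces
  \<open>g x \<ge> - g (- x) \<ge> - p (- x)\<close>, and it is subadditive because the smaller of
  two chain members can serve at both points.\<close>

lemma chain_of_sublinear_lower_bound:
  fixes p :: "'a::real_vector \<Rightarrow> real"
  assumes C: "C \<noteq> {}" and sub: "\<And>g. g \<in> C \<Longrightarrow> sublinear g \<and> g \<le> p"
    and chain: "\<And>g h. g \<in> C \<Longrightarrow> h \<in> C \<Longrightarrow> g \<le> h \<or> h \<le> g"
  shows "\<exists>u. sublinear u \<and> (\<forall>g\<in>C. u \<le> g)"
proof -
  define u where "u x = (INF g\<in>C. g x)" for x
  have "- p (- x) \<le> g x" if "g \<in> C" for g x
    using sublinear_minus[of g x] sub[OF that] by (meson le_funD neg_le_iff_le order_trans)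
  then have bdd: "bdd_below ((\<lambda>g. g x) ` C)" for x
    by (intro bdd_belowI2)
  have u_le: "u x \<le> g x" if "g \<in> C" for g x
    unfolding u_def by (rule cINF_lower[OF bdd that])
  have "u (x + y) \<le> u x + u y" for x y
  proof -
    have "u (x + y) \<le> g x + h y" if gh: "g \<in> C" "h \<in> C" for g h
    proof -
      obtain k where k: "k \<in> C" "k \<le> g" "k \<le> h"
        using chain[OF gh] gh by blast
      have "u (x + y) \<le> k x + k y"
        using u_le[OF k(1)] sublinear_add[of k x y] sub[OF k(1)] order_trans by blast
      then show ?thesis
        using le_funD[OF k(2), of x] le_funD[OF k(3), of y] by simp
    qed
    then show ?thesis
      unfolding u_def[of x] u_def[of y] by (intro le_cINF_add_cINF C)
  qed
  moreover have "u (c *\<^sub>R x) \<le> c * u x" if c: "0 < c" for c x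
    unfolding u_def[of x]
  proof (rule le_mult_cINF[OF C c])
    fix g assume "g \<in> C"
    then show "u (c *\<^sub>R x) \<le> c * g x"
      using u_le[of g "c *\<^sub>R x"] sublinear_scaleR[OF _ c, of g x] sub[of g] by simp
  qed
  ultimately show ?thesis
    using u_le unfolding sublinear_def by (metis le_funI)
qed

text \<open>
  For fixed \<open>y\<close>, the functional \<open>x \<mapsto> inf {m (x + t y) - t m y | t \<ge> 0}\<close> is again sublinear and lies
  below \<open>m\<close>; by minimality it equals \<open>m\<close>, and \<open>t = 1\<close> gives additivity.
\<close>

lemma minimal_sublinear_imp_linear:
  fixes m :: "'a::real_vector \<Rightarrow> real"
  assumes m: "sublinear m" and min: "\<And>g. sublinear g \<Longrightarrow> g \<le> m \<Longrightarrow> g = m"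
  shows "linear m"
proof -
  have add: "m (x + y) = m x + m y" for x y
  proof (rule antisym)
    show "m (x + y) \<le> m x + m y" by (rule sublinear_add[OF m])
    define g where "g x = (INF t\<in>{0::real..}. m (x + t *\<^sub>R y) - t * m y)" for x
    have scale: "m (t *\<^sub>R z) = t * m z" if "0 \<le> t" for t z
      using sublinear_scaleR[OF m, of t z] sublinear_0[OF m] that by (cases "t = 0") auto
    have "- m (- x) \<le> m (x + t *\<^sub>R y) - t * m y" if "0 \<le> t" for t x
      using sublinear_add[OF m, of "x + t *\<^sub>R y" "- x"] scale[OF that, of y] by simp
    then have bdd: "bdd_below ((\<lambda>t. m (x + t *\<^sub>R y) - t * m y) ` {0..})" for x
      by (intro bdd_belowI2) auto
    have g_le: "g x \<le> m (x + t *\<^sub>R y) - t * m y" if "0 \<le> t" for t x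
      unfolding g_def by (rule cINF_lower[OF bdd]) (use that in simp)
    have "g (x + z) \<le> g x + g z" for x z
      unfolding g_def[of x] g_def[of z]
    proof (rule le_cINF_add_cINF)
      fix s t :: real assume "s \<in> {0..}" "t \<in> {0..}"
      then have "g (x + z) \<le> m ((x + s *\<^sub>R y) + (z + t *\<^sub>R y)) - (s + t) * m y"
        using g_le[of "s + t" "x + z"] by (simp add: algebra_simps)
      then show "g (x + z) \<le> m (x + s *\<^sub>R y) - s * m y + (m (z + t *\<^sub>R y) - t * m y)"
        using sublinear_add[OF m, of "x + s *\<^sub>R y" "z + t *\<^sub>R y"] by (simp add: algebra_simps)
    qed auto
    moreover have "g (c *\<^sub>R x) \<le> c * g x" if c: "0 < c" for c x
      unfolding g_def[of x]
    proof (rule le_mult_cINF[OF _ c])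
      fix t :: real assume "t \<in> {0..}"
      then have "g (c *\<^sub>R x) \<le> m (c *\<^sub>R (x + t *\<^sub>R y)) - (c * t) * m y"
        using g_le[of "c * t" "c *\<^sub>R x"] c by (simp add: scaleR_add_right)
      then show "g (c *\<^sub>R x) \<le> c * (m (x + t *\<^sub>R y) - t * m y)"
        using scale[of c "x + t *\<^sub>R y"] c by (simp add: right_diff_distrib mult.assoc)
    qed auto
    ultimately have "sublinear g"
      by (simp add: sublinear_def)
    moreover have "g \<le> m"
      using g_le[of 0] by (simp add: le_fun_def)
    ultimately have "g = m" by (rule min)
    then show "m x + m y \<le> m (x + y)"
      using g_le[of 1 x] by simp
  qed
  have neg: "m (- x) = - m x" for x
    using add[of x "- x"] sublinear_0[OF m] by simp
  have "m (c *\<^sub>R x) = c * m x" for c x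
  proof (cases "0 < c")
    case True
    then show ?thesis by (rule sublinear_scaleR[OF m])
  next
    case False
    then show ?thesis
      using sublinear_scaleR[OF m, of "- c" "- x"] neg[of x] sublinear_0[OF m]
      by (cases "c = 0") auto
  qed
  with add show ?thesis
    by (intro linearI) auto
qed

text \<open>Zorn's lemma in the reversed pointwise order yields a minimal sublinear functional below
  \<open>p\<close>, and minimality forces linearity.\<close>

theorem Hahn_Banach_sublinear:
  fixes p :: "'a::real_vector \<Rightarrow> real"
  assumes p: "sublinear p"
  shows "\<exists>q. linear q \<and> q \<le> p"
proof -
  define S where "S = {g. sublinear g \<and> g \<le> p}"
  have "\<exists>m\<in>S. \<forall>g\<in>S. m \<ge> g \<longrightarrow> g = m"
  proof (rule predicate_Zorn)
    show "partial_order_on S (relation_of (\<ge>) S)"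
      by (rule partial_order_on_relation_ofI) auto
    fix C assume C: "C \<in> Chains (relation_of (\<ge>) S)"
    then have sub: "\<And>g. g \<in> C \<Longrightarrow> g \<in> S"
      and chain: "\<And>g h. g \<in> C \<Longrightarrow> h \<in> C \<Longrightarrow> g \<le> h \<or> h \<le> g"
      by (auto simp: Chains_def relation_of_def)
    show "\<exists>u\<in>S. \<forall>a\<in>C. a \<ge> u"
    proof (cases "C = {}")
      case True
      then show ?thesis using p by (auto simp: S_def)
    next
      case False
      then obtain u where "sublinear u" "\<forall>g\<in>C. u \<le> g"
        using chain_of_sublinear_lower_bound[of C p] sub chain by (auto simp: S_def)
      moreover from False sub this(2) have "u \<le> p"
        by (fastforce simp: S_def intro: order_trans)
      ultimately show ?thesis by (auto simp: S_def)
    qed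
  qed
  then obtain m where "m \<in> S" "\<And>g. g \<in> S \<Longrightarrow> g \<le> m \<Longrightarrow> g = m" by blast
  then show ?thesis
    using minimal_sublinear_imp_linear[of m] by (auto simp: S_def intro: order_trans)
qed

text \<open>The infimum \<open>P\<close> is the directional derivative of \<open>p\<close> at the
  origin, a sublinear functional below \<open>p\<close>, so the sublinear case applies.\<close>

corollary Hahn_Banach_convex:
  fixes p :: "'a::real_vector \<Rightarrow> real"
  assumes p: "convex_on UNIV p" and p0: "p 0 = 0"
  shows "\<exists>q. linear q \<and> q \<le> p"
proof -
  define P where "P x = (INF t\<in>{0<..}. p (t *\<^sub>R x) / t)" for x
  have "- p (- x) \<le> p (t *\<^sub>R x) / t" if t: "0 < t" for t x
  proof -
    \<comment> \<open>These weights place the origin between \<open>t *\<^sub>R x\<close> and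
      \<open>- x\<close>, so that \<open>p 0 = 0\<close> bounds the quotient from below.\<close>
    define r where "r = t / (1 + t)"
    have r: "0 \<le> r" "r \<le> 1" "1 - r = 1 / (1 + t)" "r \<noteq> 0" using t by (auto simp: r_def field_simps)
    have "p ((1 - r) *\<^sub>R (t *\<^sub>R x) + r *\<^sub>R (- x)) \<le> (1 - r) * p (t *\<^sub>R x) + r * p (- x)"
      by (rule convex_onD[OF p]) (use r in auto)
    moreover have "(1 - r) *\<^sub>R (t *\<^sub>R x) + r *\<^sub>R (- x) = 0"
      using r(3) by (simp add: r_def)
    ultimately have "0 \<le> (1 - r) * p (t *\<^sub>R x) + r * p (- x)"
      using p0 by metis
    then have "0 \<le> p (t *\<^sub>R x) / (1 + t) + t * p (- x) / (1 + t)"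
      by (simp add: r(3)) (simp add: r_def)
    then have "0 \<le> (p (t *\<^sub>R x) + t * p (- x)) / (1 + t)"
      by (simp add: add_divide_distrib)
    then have "0 \<le> p (t *\<^sub>R x) + t * p (- x)"
      using t by (simp add: zero_le_divide_iff)
    then show ?thesis using t by (simp add: field_simps)
  qed
  then have bdd: "bdd_below ((\<lambda>t. p (t *\<^sub>R x) / t) ` {0<..})" for x
    by (intro bdd_belowI2) auto
  have P_le: "P x \<le> p (t *\<^sub>R x) / t" if "0 < t" for t x
    unfolding P_def by (rule cINF_lower[OF bdd]) (use that in simp)
  have ne: "{0::real<..} \<noteq> {}" by (rule greaterThan_non_empty)
  have "P (x + y) \<le> P x + P y" for x y
    unfolding P_def[of x] P_def[of y]
  proof (rule le_cINF_add_cINF[OF ne ne])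
    fix t u :: real assume "t \<in> {0<..}" "u \<in> {0<..}"
    then have tu: "0 < t" "0 < u" by auto
    \<comment> \<open>With these weights \<open>x\<close> and \<open>y\<close> get the common
      coefficient \<open>t * u / (t + u)\<close>, so the combination is a multiple of
      \<open>x + y\<close>.\<close>
    define r where "r = t / (t + u)"
    have r: "0 \<le> r" "r \<le> 1" "1 - r = u / (t + u)" "0 < r" using tu by (auto simp: r_def field_simps)
    have ru: "0 < r * u" using r tu by simp
    have "p ((1 - r) *\<^sub>R (t *\<^sub>R x) + r *\<^sub>R (u *\<^sub>R y)) \<le> (1 - r) * p (t *\<^sub>R x) + r * p (u *\<^sub>R y)"
      by (rule convex_onD[OF p]) (use r in auto)
    moreover have "(1 - r) *\<^sub>R (t *\<^sub>R x) + r *\<^sub>R (u *\<^sub>R y) = (r * u) *\<^sub>R (x + y)"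
      unfolding r(3) by (simp add: r_def scaleR_add_right mult.commute)
    ultimately have "p ((r * u) *\<^sub>R (x + y)) / (r * u) \<le> ((1 - r) * p (t *\<^sub>R x) + r * p (u *\<^sub>R y)) / (r * u)"
      using ru by (simp add: divide_right_mono)
    also have "\<dots> = (1 - r) / (r * u) * p (t *\<^sub>R x) + p (u *\<^sub>R y) / u"
      using r(4) tu by (simp add: add_divide_distrib)
    also have "(1 - r) / (r * u) = 1 / t"
      unfolding r(3) using tu by (simp add: r_def)
    finally show "P (x + y) \<le> p (t *\<^sub>R x) / t + p (u *\<^sub>R y) / u"
      using P_le[OF ru, of "x + y"] by simp
  qed
  moreover have "P (c *\<^sub>R x) \<le> c * P x" if c: "0 < c" for c x
    unfolding P_def[of x]
  proof (rule le_mult_cINF[OF ne c])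
    fix t :: real assume "t \<in> {0<..}"
    then show "P (c *\<^sub>R x) \<le> c * (p (t *\<^sub>R x) / t)"
      using P_le[of "t / c" "c *\<^sub>R x"] c by (simp add: field_simps)
  qed
  ultimately have "sublinear P" by (simp add: sublinear_def)
  then obtain q where "linear q" "q \<le> P" using Hahn_Banach_sublinear by blast
  moreover have "P \<le> p" using P_le[of 1] by (simp add: le_fun_def)
  ultimately show ?thesis by (blast intro: order_trans)
qed

section \<open>Subgradients at the minimum of a convex sum\<close>

lemma bounded_linear_if_bounded_above_near_0:
  fixes q :: "'a::real_normed_vector \<Rightarrow> real"
  assumes q: "linear q" and d: "0 < d" and le: "\<And>v. norm v < d \<Longrightarrow> q v \<le> 1"
  shows "bounded_linear q"
proof -
  have le': "q v \<le> norm v * (2 / d)" for v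
  proof (cases "v = 0")
    case True
    then show ?thesis using linear_0[OF q] by simp
  next
    case False
    define c where "c = d / (2 * norm v)"
    have c: "0 < c" "c * norm v = d / 2" using False d by (auto simp: c_def)
    have "q (c *\<^sub>R v) \<le> 1" using c d by (intro le) simp
    then have "q v \<le> 1 / c" using c(1) linear_scale[OF q] by (simp add: field_simps)
    then show ?thesis by (simp add: c_def mult.commute)
  qed
  have "norm (q v) \<le> norm v * (2 / d)" for v
    using le'[of v] le'[of "- v"] linear_neg[OF q, of v] by (simp add: abs_if)
  then show ?thesis
    using q by (intro bounded_linear_intro[where K = "2 / d"]) (auto simp: linear_add linear_scale)
qed

text \<open>The functional comes from Hahn-Banach applied to the infimal convolution of \<open>f\<close> and the reflected \<open>k\<close>.\<close>

lemma convex_sum_rule_at_minimum: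
  fixes f k :: "'a::real_normed_vector \<Rightarrow> real"
  assumes f: "convex_on D f" and s: "s \<in> D"
    and k: "convex_on UNIV k" and cont: "isCont k s"
    and min: "\<And>z. z \<in> D \<Longrightarrow> f s + k s \<le> f z + k z"
  shows "\<exists>q::'a \<Rightarrow>\<^sub>L real. (\<forall>z\<in>D. f s + q (z - s) \<le> f z) \<and> (\<forall>z. k s \<le> k z + q (z - s))"
proof -
  have D: "convex D" using f by (simp add: convex_on_def)
  have ne: "D \<noteq> {}" using s by blast
  define P where "P v = (INF z\<in>D. f z + k (z - v))" for v
  \<comment> \<open>The midpoint of \<open>z\<close> and \<open>s\<close> is also the midpoint of
    \<open>z - v\<close> and \<open>s + v\<close>; minimality there, with convexity of
    \<open>f\<close> and \<open>k\<close>, bounds the infimal convolution from below.\<close>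
  have "f s + 2 * k s - k (s + v) \<le> f z + k (z - v)" if z: "z \<in> D" for z v
  proof -
    let ?z = "(1 - 1/2) *\<^sub>R z + (1/2) *\<^sub>R s"
    have "?z \<in> D" by (rule convexD_alt[OF D z s]) auto
    then have "f s + k s \<le> f ?z + k ?z" by (rule min)
    moreover have "f ?z \<le> (1 - 1/2) * f z + (1/2) * f s"
      by (rule convex_onD[OF f _ _ z s]) auto
    moreover have "k ((1 - 1/2) *\<^sub>R (z - v) + (1/2) *\<^sub>R (s + v)) \<le> (1 - 1/2) * k (z - v) + (1/2) * k (s + v)"
      by (rule convex_onD[OF k]) auto
    moreover have "(1 - 1/2) *\<^sub>R (z - v) + (1/2) *\<^sub>R (s + v) = ?z"
      by (simp add: algebra_simps)
    ultimately show ?thesis by simp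
  qed
  then have bdd: "bdd_below ((\<lambda>z. f z + k (z - v)) ` D)" for v
    by (intro bdd_belowI2)
  have P_le: "P v \<le> f z + k (z - v)" if "z \<in> D" for v z
    unfolding P_def by (rule cINF_lower[OF bdd that])
  have P0: "P 0 = f s + k s"
  proof (rule antisym)
    show "P 0 \<le> f s + k s" using P_le[OF s, of 0] by simp
    show "f s + k s \<le> P 0" unfolding P_def by (rule cINF_greatest[OF ne]) (simp add: min)
  qed
  have "convex_on UNIV P"
  proof (rule convex_onI)
    fix t :: real and v w :: 'a assume t: "0 < t" "t < 1"
    let ?v = "(1 - t) *\<^sub>R v + t *\<^sub>R w"
    have "P ?v \<le> (1 - t) * (f y + k (y - v)) + t * (f z + k (z - w))" if yz: "y \<in> D" "z \<in> D" for y z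
    proof -
      let ?z = "(1 - t) *\<^sub>R y + t *\<^sub>R z"
      have "?z \<in> D" by (rule convexD_alt[OF D yz]) (use t in auto)
      then have "P ?v \<le> f ?z + k (?z - ?v)" by (rule P_le)
      moreover have "f ?z \<le> (1 - t) * f y + t * f z"
        by (rule convex_onD[OF f _ _ yz]) (use t in auto)
      moreover have "k ((1 - t) *\<^sub>R (y - v) + t *\<^sub>R (z - w)) \<le> (1 - t) * k (y - v) + t * k (z - w)"
        by (rule convex_onD[OF k]) (use t in auto)
      moreover have "(1 - t) *\<^sub>R (y - v) + t *\<^sub>R (z - w) = ?z - ?v"
        by (simp add: algebra_simps)
      ultimately show ?thesis by (simp add: distrib_left)
    qed
    then have "P ?v - t * (f z + k (z - w)) \<le> (1 - t) * P v" if "z \<in> D" for z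
      unfolding P_def[of v] using that t
      by (intro le_mult_cINF ne) (auto simp: algebra_simps)
    then have "P ?v - (1 - t) * P v \<le> t * P w"
      unfolding P_def[of w] using t
      by (intro le_mult_cINF ne) (auto simp: algebra_simps)
    then show "P ?v \<le> (1 - t) * P v + t * P w" by simp
  qed simp
  then have "convex_on UNIV (\<lambda>v. P v + - P 0)"
    by (intro convex_on_add) (auto simp: convex_on_const)
  then obtain q where q: "linear q" and "q \<le> (\<lambda>v. P v + - P 0)"
    using Hahn_Banach_convex[of "\<lambda>v. P v + - P 0"] by auto
  then have "q v \<le> P v + - P 0" for v by (rule_tac le_funD)
  \<comment> \<open>Both conclusions are instances of this inequality: \<open>v = z - s\<close>
    cancels the values of \<open>k\<close>, and \<open>z = s\<close> compares \<open>q\<close> with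
    \<open>k\<close>, whose continuity at \<open>s\<close> then makes \<open>q\<close>
    bounded.\<close>
  with P_le P0 have q_le: "q v \<le> f z + k (z - v) - (f s + k s)" if "z \<in> D" for v z
    using that by (smt (verit))
  have q_le_k: "q v \<le> k (s - v) - k s" for v using q_le[OF s, of v] by simp
  obtain d where d: "0 < d" and near: "\<And>z. dist z s < d \<Longrightarrow> dist (k z) (k s) < 1"
    using cont by (metis zero_less_one continuous_at_eps_delta)
  have "q v \<le> 1" if "norm v < d" for v
    using q_le_k[of v] near[of "s - v"] that by (simp add: dist_norm)
  then have "bounded_linear q"
    by (rule bounded_linear_if_bounded_above_near_0[OF q d])
  then have Bq: "blinfun_apply (Blinfun q) = q" by (rule bounded_linear_Blinfun_apply)
  have "f s + q (z - s) \<le> f z" if "z \<in> D" for z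
    using q_le[OF that, of "z - s"] by simp
  moreover have "k s \<le> k z + q (z - s)" for z
    using q_le_k[of "s - z"] linear_neg[OF q, of "s - z"] by simp
  ultimately show ?thesis
    by (intro exI[of _ "Blinfun q"]) (simp add: Bq)
qed

subsection \<open>Ekeland's variational principle\<close>

lemma lsc_fun_add_continuous:
  fixes g :: "'a::metric_space \<Rightarrow> ereal" and k :: "'a \<Rightarrow> real"
  assumes g: "lsc_fun g" and k: "continuous_on UNIV k"
  shows "lsc_fun (\<lambda>x. g x + ereal (k x))"
  unfolding lsc_fun_def closed_sequential_limits
proof (intro allI impI, elim conjE)
  fix c :: real and x l assume x: "\<forall>n. x n \<in> {x. g x + ereal (k x) \<le> ereal c}" and lim: "x \<longlonglongrightarrow> l"
  have "(\<lambda>n. k (x n)) \<longlonglongrightarrow> k l"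
    using k lim by (simp add: continuous_on_eq_continuous_at isCont_tendsto_compose)
  have "g l \<le> ereal (c - k l) + ereal e" if e: "0 < e" for e
  proof -
    have "\<forall>\<^sub>F n in sequentially. k l - e < k (x n)"
      using \<open>(\<lambda>n. k (x n)) \<longlonglongrightarrow> k l\<close> e by (intro order_tendstoD(1)) auto
    then have ev: "\<forall>\<^sub>F n in sequentially. x n \<in> {x. g x \<le> ereal (c - k l + e)}"
    proof eventually_elim
      case (elim n)
      then show ?case using x[rule_format, of n] by (cases "g (x n)") auto
    qed
    have "closed {x. g x \<le> ereal (c - k l + e)}" using g by (simp add: lsc_fun_def)
    from Lim_in_closed_set[OF this ev _ lim] show ?thesis by simp
  qed
  then have "g l \<le> ereal (c - k l)" by (rule ereal_le_epsilon2) blast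
  then show "l \<in> {x. g x + ereal (k x) \<le> ereal c}" by (cases "g l") auto
qed

text \<open>Choose \<open>x (Suc n)\<close> in \<open>A (x n)\<close> almost minimising
  \<open>g\<close> there. The sets \<open>A (x n)\<close> are then closed, nested and of vanishing
  diameter, so completeness gives a common point \<open>a\<close>; transitivity of the relation
  behind \<open>A\<close> leaves only \<open>a\<close> in \<open>A a\<close>.\<close>

theorem Ekeland_variational_principle:
  fixes g :: "'a::complete_space \<Rightarrow> ereal"
  assumes lsc: "lsc_fun g" and lb: "\<And>x. ereal m \<le> g x" and x0: "g x0 \<noteq> \<infinity>" and K: "0 < K"
  shows "\<exists>s. g s \<noteq> \<infinity> \<and> (\<forall>z. g s \<le> g z + ereal (K * dist s z))"
proof -
  define h where "h x = real_of_ereal (g x)" for x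
  have g_eq: "g x = ereal (h x)" if "g x \<noteq> \<infinity>" for x
    using lb[of x] that by (cases "g x") (auto simp: h_def)
  have h_ge: "m \<le> h x" if "g x \<noteq> \<infinity>" for x
    using lb[of x] g_eq[OF that] by simp
  define A where "A x = {z. g z + ereal (K * dist x z) \<le> g x}" for x
  have A_iff: "z \<in> A x \<longleftrightarrow> g z \<noteq> \<infinity> \<and> h z + K * dist x z \<le> h x" if "g x \<noteq> \<infinity>" for x z
  proof (cases "g z = \<infinity>")
    case True
    then show ?thesis using g_eq[OF that] by (simp add: A_def)
  next
    case False
    then show ?thesis using g_eq[OF that] g_eq[OF False] by (simp add: A_def)
  qed
  have A_trans: "A z \<subseteq> A x" if x: "g x \<noteq> \<infinity>" and z: "z \<in> A x" for x z
  proof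
    fix y assume y: "y \<in> A z"
    have "g z \<noteq> \<infinity>" using A_iff[OF x] z by simp
    with y z x have "g y \<noteq> \<infinity>" "h y + K * dist z y \<le> h z" "h z + K * dist x z \<le> h x"
      by (auto simp: A_iff)
    moreover have "K * dist x y \<le> K * dist x z + K * dist z y"
      using K dist_triangle[of x y z] by (simp add: distrib_left[symmetric])
    ultimately show "y \<in> A x" using A_iff[OF x] by simp
  qed
  have step: "\<exists>y. g y \<noteq> \<infinity> \<and> (y \<in> A x \<and> (\<forall>z\<in>A x. h y \<le> h z + e))"
    if x: "g x \<noteq> \<infinity>" and e: "0 < e" for x e
  proof -
    have bdd: "bdd_below (h ` A x)"
      using A_iff[OF x] h_ge by (intro bdd_belowI2[of _ m]) auto
    have "x \<in> A x" using A_iff[OF x] x by simp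
    then have "h ` A x \<noteq> {}" by blast
    then have "\<exists>v\<in>h ` A x. v < Inf (h ` A x) + e"
      using cInf_lessD[of "h ` A x" "Inf (h ` A x) + e"] e by auto
    then obtain y where y: "y \<in> A x" "h y < Inf (h ` A x) + e" by blast
    moreover have "Inf (h ` A x) \<le> h z" if "z \<in> A x" for z
      using that bdd by (intro cInf_lower) auto
    ultimately have "\<forall>z\<in>A x. h y \<le> h z + e" by fastforce
    with y(1) show ?thesis using A_iff[OF x] by blast
  qed
  have "\<exists>x. \<forall>n. g (x n) \<noteq> \<infinity> \<and>
      (x (Suc n) \<in> A (x n) \<and> (\<forall>z\<in>A (x n). h (x (Suc n)) \<le> h z + (1/2) ^ n))"
  proof (rule dependent_nat_choice)
    show "\<exists>y. g y \<noteq> \<infinity>" using x0 by blast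
  qed (rule step, auto)
  then obtain x where fin: "\<And>n. g (x n) \<noteq> \<infinity>" and nxt: "\<And>n. x (Suc n) \<in> A (x n)"
    and small: "\<And>n z. z \<in> A (x n) \<Longrightarrow> h (x (Suc n)) \<le> h z + (1/2) ^ n"
    by blast
  have closed: "closed (A (x n))" for n
  proof -
    have "lsc_fun (\<lambda>z. g z + ereal (K * dist (x n) z))"
      by (intro lsc_fun_add_continuous lsc continuous_intros)
    then show ?thesis unfolding A_def g_eq[OF fin] lsc_fun_def by blast
  qed
  have anti: "A (x n) \<subseteq> A (x j)" if "j \<le> n" for j n
    using that by (rule lift_Suc_antimono_le[rotated]) (intro A_trans fin nxt)
  have near: "K * dist (x (Suc n)) z \<le> (1/2) ^ n" if z: "z \<in> A (x (Suc n))" for n z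
  proof -
    have "h z + K * dist (x (Suc n)) z \<le> h (x (Suc n))" using z A_iff[OF fin] by blast
    moreover have "h (x (Suc n)) \<le> h z + (1/2) ^ n" using z A_trans[OF fin nxt] small by blast
    ultimately show ?thesis by simp
  qed
  have diam: "\<exists>n. \<forall>y\<in>A (x n). \<forall>z\<in>A (x n). dist y z < e" if e: "0 < e" for e
  proof -
    obtain n where n: "(1/2) ^ n < K * e / 2"
      using real_arch_pow_inv[of "K * e / 2" "1/2"] K e by auto
    have "dist y z < e" if yz: "y \<in> A (x (Suc n))" "z \<in> A (x (Suc n))" for y z
    proof -
      have "K * dist y z \<le> K * (dist (x (Suc n)) y + dist (x (Suc n)) z)"
        using K dist_triangle3[of y z "x (Suc n)"] by simp
      also have "\<dots> < K * e" using near[OF yz(1)] near[OF yz(2)] n by (simp add: distrib_left)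
      finally show ?thesis using K by simp
    qed
    then show ?thesis by blast
  qed
  have "A (x n) \<noteq> {}" for n using nxt by blast
  with closed anti diam obtain a where a: "\<And>n. a \<in> A (x n)"
    using decreasing_closed_nest[of "\<lambda>n. A (x n)"] by blast
  have fin_a: "g a \<noteq> \<infinity>" using a[of 0] A_iff[OF fin] by blast
  have "z = a" if "z \<in> A a" for z
  proof (rule ccontr)
    assume "z \<noteq> a"
    then obtain n where "\<forall>y\<in>A (x n). \<forall>z'\<in>A (x n). dist y z' < dist a z"
      using diam[of "dist a z"] by auto
    moreover have "z \<in> A (x n)" using A_trans[OF fin a] that by blast
    ultimately show False using a[of n] by blast
  qed
  \<comment> \<open>A point outside \<open>A a\<close> satisfies the claim by totality of the order,
    and the only point inside is \<open>a\<close> itself.\<close>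
  then have "g a \<le> g z + ereal (K * dist a z)" for z
    using linear[of "g a" "g z + ereal (K * dist a z)"]
    by (metis (mono_tags, lifting) A_def add.right_neutral dist_self mem_Collect_eq mult_zero_right order_refl zero_ereal_def)
  with fin_a show ?thesis by blast
qed

subsection \<open>Conjugates, subdifferentials and the Fitzpatrick function\<close>

lemma convex_on_blinfun_apply: "convex_on UNIV (blinfun_apply (w :: 'a::real_normed_vector \<Rightarrow>\<^sub>L real))"
  by (simp add: convex_on_def blinfun.add_right blinfun.scaleR_right)

lemma convex_on_norm_diff_power2: "convex_on UNIV (\<lambda>z::'a::real_normed_vector. (norm (z - x))\<^sup>2)"
proof (rule convex_onI)
  fix t :: real and y z :: 'a assume t: "0 < t" "t < 1"
  let ?a = "norm (y - x)" and ?b = "norm (z - x)"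
  have "(1 - t) *\<^sub>R y + t *\<^sub>R z - x = (1 - t) *\<^sub>R (y - x) + t *\<^sub>R (z - x)"
    by (simp add: algebra_simps)
  then have "norm ((1 - t) *\<^sub>R y + t *\<^sub>R z - x) \<le> (1 - t) * ?a + t * ?b"
    using norm_triangle_ineq[of "(1 - t) *\<^sub>R (y - x)" "t *\<^sub>R (z - x)"] t by simp
  then have "(norm ((1 - t) *\<^sub>R y + t *\<^sub>R z - x))\<^sup>2 \<le> ((1 - t) * ?a + t * ?b)\<^sup>2"
    by (intro power_mono) auto
  also have "\<dots> = (1 - t) * ?a\<^sup>2 + t * ?b\<^sup>2 - t * (1 - t) * (?a - ?b)\<^sup>2"
    by (simp add: power2_eq_square algebra_simps)
  also have "\<dots> \<le> (1 - t) * ?a\<^sup>2 + t * ?b\<^sup>2"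
    using t by simp
  finally show "(norm ((1 - t) *\<^sub>R y + t *\<^sub>R z - x))\<^sup>2 \<le> (1 - t) * ?a\<^sup>2 + t * ?b\<^sup>2" .
qed simp

text \<open>A one-sided bound suffices because the ball is symmetric. Radius 0 is included since the
  radius used later, \<open>norm y'' + norm x\<close>, may vanish.\<close>

lemma norm_blinfun_mult_le:
  fixes w :: "'a::real_normed_vector \<Rightarrow>\<^sub>L real"
  assumes r: "0 \<le> r" and le: "\<And>v. norm v \<le> r \<Longrightarrow> w v \<le> B"
  shows "norm w * r \<le> B"
proof (cases "r = 0")
  case True
  then show ?thesis using le[of 0] by (simp add: blinfun.zero_right)
next
  case False
  with r have r: "0 < r" by simp
  have B: "0 \<le> B" using le[of 0] r by (simp add: blinfun.zero_right)
  have "norm w \<le> B / r"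
  proof (rule norm_blinfun_bound)
    fix v
    show "norm (blinfun_apply w v) \<le> B / r * norm v"
    proof (cases "v = 0")
      case False
      have "w ((r / norm v) *\<^sub>R v) \<le> B" "w (- (r / norm v) *\<^sub>R v) \<le> B"
        using False r by (intro le; simp)+
      then have "\<bar>r / norm v * w v\<bar> \<le> B"
        by (auto simp: blinfun.scaleR_right blinfun.minus_right)
      then show ?thesis using False r by (simp add: abs_mult field_simps)
    qed (simp add: blinfun.zero_right)
  qed (use B r in simp)
  then show ?thesis using r by (simp add: field_simps)
qed

lemma fconj_upper: "ereal (blinfun_apply x' x) - f x \<le> fconj f x'"
  unfolding fconj_def by (rule SUP_upper) simp

lemma fenchel_young:
  assumes "f x \<noteq> -\<infinity>"
  shows "ereal (blinfun_apply x' x) \<le> f x + fconj f x'"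
  using fconj_upper[of x' x f] assms by (cases "f x"; cases "fconj f x'") auto

lemma fconj_neq_MInf:
  assumes "proper_fun f"
  shows "fconj f x' \<noteq> -\<infinity>"
proof -
  obtain x where "f x \<noteq> \<infinity>" "f x \<noteq> -\<infinity>" using assms by (auto simp: proper_fun_def)
  then show ?thesis using fconj_upper[of x' x f] by (cases "f x") auto
qed

lemma subdiff_graph_finite:
  assumes f: "proper_fun f" and s: "(s, s') \<in> subdiff_graph f"
  obtains r r' where "f s = ereal r" "fconj f s' = ereal r'" "r + r' = blinfun_apply s' s"
proof -
  have "f s + fconj f s' = ereal (blinfun_apply s' s)" using s by (simp add: subdiff_graph_def)
  moreover have "f s \<noteq> -\<infinity>" using f by (simp add: proper_fun_def)
  ultimately show ?thesis
    using that fconj_neq_MInf[OF f, of s'] by (cases "f s"; cases "fconj f s'") auto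
qed

lemma subdiff_graphI:
  assumes fs: "f s = ereal r" and le: "\<And>z. ereal (r + blinfun_apply s' (z - s)) \<le> f z"
  shows "(s, s') \<in> subdiff_graph f"
proof -
  have "fconj f s' = ereal (blinfun_apply s' s - r)"
  proof (rule antisym)
    show "fconj f s' \<le> ereal (blinfun_apply s' s - r)"
      unfolding fconj_def
    proof (rule SUP_least)
      fix z
      show "ereal (blinfun_apply s' z) - f z \<le> ereal (blinfun_apply s' s - r)"
        using le[of z] by (cases "f z") (auto simp: blinfun.diff_right)
    qed
    show "ereal (blinfun_apply s' s - r) \<le> fconj f s'"
      using fconj_upper[of s' s f] fs by simp
  qed
  then show ?thesis using fs by (simp add: subdiff_graph_def)
qed

text \<open>Add Fenchel-Young for the pairs \<open>(s, x')\<close> and \<open>(x, s')\<close> and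
  subtract the equality at \<open>(s, s')\<close>.\<close>

lemma fitz_fun_subdiff_le:
  assumes f: "proper_fun f"
  shows "fitz_fun (subdiff_graph f) x x' \<le> f x + fconj f x'"
  unfolding fitz_fun_def
proof (rule SUP_least)
  fix p assume "p \<in> subdiff_graph f"
  then obtain s s' where p: "p = (s, s')" "(s, s') \<in> subdiff_graph f" by (cases p) auto
  from subdiff_graph_finite[OF f p(2)] obtain r r' where
    r: "f s = ereal r" "fconj f s' = ereal r'" "r + r' = blinfun_apply s' s" by blast
  have "ereal (blinfun_apply x' s) \<le> f s + fconj f x'" "ereal (blinfun_apply s' x) \<le> f x + fconj f s'"
    using f by (auto intro!: fenchel_young simp: proper_fun_def)
  then show "ereal (blinfun_apply x' (fst p) + blinfun_apply (snd p) x - blinfun_apply (snd p) (fst p))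
      \<le> f x + fconj f x'"
    using r p(1) by (cases "f x"; cases "fconj f x'") auto
qed

text \<open>The conjugate of \<open>f x + fconj f x'\<close> splits because the variables are
  separate; the suprema over \<open>x\<close> and \<open>x'\<close> are taken one after the other. A
  graph point, where both terms are finite, keeps the right-hand side away from
  \<open>-\<infinity>\<close>.\<close>

lemma fconj_add_le_fitz_conj:
  assumes f: "proper_fun f" and ne: "subdiff_graph f \<noteq> {}"
  shows "fconj f y' + fconj (fconj f) y'' \<le> fitz_conj (subdiff_graph f) y' y''"
    (is "_ \<le> ?F")
proof (cases "?F = \<infinity>")
  case False
  have upper: "ereal (blinfun_apply y' x + blinfun_apply y'' x' - r - r') \<le> ?F"
    if "f x = ereal r" "fconj f x' = ereal r'" for x x' r r'
  proof -
    have "ereal (blinfun_apply y' x + blinfun_apply y'' x') - fitz_fun (subdiff_graph f) x x' \<le> ?F"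
      unfolding fitz_conj_def
      using SUP_upper[of "(x, x')" UNIV "\<lambda>p. ereal (blinfun_apply y' (fst p) + blinfun_apply y'' (snd p))
        - fitz_fun (subdiff_graph f) (fst p) (snd p)"] by simp
    then show ?thesis
      using fitz_fun_subdiff_le[OF f, of x x'] that False
      by (cases "fitz_fun (subdiff_graph f) x x'"; cases ?F) auto
  qed
  obtain s s' where "(s, s') \<in> subdiff_graph f" using ne by auto
  from subdiff_graph_finite[OF f this] obtain r r' where
    r: "f s = ereal r" "fconj f s' = ereal r'" by blast
  then obtain c where c: "?F = ereal c" using upper[OF r] False by (cases ?F) auto
  have fy: "fconj f y' \<le> ereal (c - blinfun_apply y'' x' + t)" if x': "fconj f x' = ereal t" for x' t
    unfolding fconj_def[of f y']
  proof (rule SUP_least)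
    fix x
    show "ereal (blinfun_apply y' x) - f x \<le> ereal (c - blinfun_apply y'' x' + t)"
      using upper[OF _ x', of x] c f by (cases "f x") (auto simp: proper_fun_def)
  qed
  then obtain a where a: "fconj f y' = ereal a"
    using fy[OF r(2)] fconj_neq_MInf[OF f, of y'] by (cases "fconj f y'") auto
  have "fconj (fconj f) y'' \<le> ereal (c - a)"
    unfolding fconj_def[of "fconj f" y'']
  proof (rule SUP_least)
    fix x'
    show "ereal (blinfun_apply y'' x') - fconj f x' \<le> ereal (c - a)"
      using fy[of x'] a fconj_neq_MInf[OF f, of x'] by (cases "fconj f x'") auto
  qed
  then show ?thesis using a c by (cases "fconj (fconj f) y''") auto
qed simp

section \<open>Approximation of bidual subgradients by points of the graph\<close>

text \<open>
  The left-hand side below is \<open>\<langle>s - x, s' - x'\<rangle>\<close> and the right-hand side is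
  \<open>\<langle>y' - x', y'' - x\<rangle> + e\<close>, with \<open>x\<close> embedded in the bidual.
\<close>

lemma subdiff_graph_near_bidual_subgradient:
  fixes f :: "'a::banach \<Rightarrow> ereal"
  assumes f: "proper_fun f" "convex_fun f" "lsc_fun f"
    and y: "fconj f y' + fconj (fconj f) y'' = ereal (blinfun_apply y'' y')" and e: "0 < e"
  shows "\<exists>s s'. (s, s') \<in> subdiff_graph f \<and>
    blinfun_apply (s' - x') (s - x) \<le> blinfun_apply y'' (y' - x') - blinfun_apply (y' - x') x + e"
proof -
  obtain a b where a: "fconj f y' = ereal a" and b: "fconj (fconj f) y'' = ereal b"
    and ab: "a + b = blinfun_apply y'' y'"
    using y fconj_neq_MInf[OF f(1), of y'] by (cases "fconj f y'"; cases "fconj (fconj f) y''") auto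
  define D where "D = {z. f z \<noteq> \<infinity>}"
  define h where "h z = real_of_ereal (f z)" for z
  have f_eq: "f z = ereal (h z)" if "z \<in> D" for z
    using that f(1) by (cases "f z") (auto simp: D_def h_def proper_fun_def)
  obtain x0 where x0: "x0 \<in> D" using f(1) by (auto simp: D_def proper_fun_def)
  have h_ge: "blinfun_apply y' z - a \<le> h z" if "z \<in> D" for z
    using fenchel_young[of f z y'] f_eq[OF that] a by simp
  have mixed: "f ((1 - t) *\<^sub>R y + t *\<^sub>R z) \<le> ereal ((1 - t) * h y + t * h z)"
    if "0 < t" "t < 1" "y \<in> D" "z \<in> D" for t y z
  proof -
    have "f ((1 - t) *\<^sub>R y + (1 - (1 - t)) *\<^sub>R z) \<le> ereal (1 - t) * f y + ereal (1 - (1 - t)) * f z"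
      using f(2)[unfolded convex_fun_def, rule_format, of "1 - t"] that by simp
    then show ?thesis using f_eq that by simp
  qed
  have h_convex: "convex_on D h"
  proof (rule convex_onI)
    show "convex D"
      unfolding convex_alt
    proof (intro ballI allI impI)
      fix y z and t :: real assume "y \<in> D" "z \<in> D" "0 \<le> t \<and> t \<le> 1"
      then show "(1 - t) *\<^sub>R y + t *\<^sub>R z \<in> D"
        using mixed[of t y z] by (cases "t = 0"; cases "t = 1") (auto simp: D_def)
    qed
    fix t :: real and y z assume tyz: "0 < t" "t < 1" "y \<in> D" "z \<in> D"
    then have "(1 - t) *\<^sub>R y + t *\<^sub>R z \<in> D"
      using mixed[of t y z] by (auto simp: D_def)
    then show "h ((1 - t) *\<^sub>R y + t *\<^sub>R z) \<le> (1 - t) * h y + t * h z"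
      using mixed[OF tyz] f_eq by simp
  qed
  define u where "u = y' - x'"
  \<comment> \<open>The target value \<open>c\<close> is the pairing of \<open>u\<close> with
    \<open>y'' - x\<close>, and \<open>\<rho>\<close> bounds the norm of \<open>y'' - x\<close>.
    \<open>M\<close> collects the coefficients of \<open>\<tau>\<close> in the final estimate, and
    \<open>\<tau>\<close> is chosen so that \<open>\<tau> * M \<le> e\<close>.\<close>
  define c where "c = blinfun_apply y'' u - blinfun_apply u x"
  define \<rho> where "\<rho> = norm y'' + norm x"
  define M where "M = \<bar>c\<bar> + (\<rho> + 1)\<^sup>2 + 1"
  define \<tau> where "\<tau> = e / (M + e)"
  have "0 < M" by (simp add: M_def add_nonneg_pos)
  then have \<tau>: "0 < \<tau>" "\<tau> < 1" "\<tau> * M \<le> e" using e by (auto simp: \<tau>_def field_simps)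
  \<comment> \<open>With the square, errors of order \<open>\<delta>\<close> still vanish after
    division by \<open>\<tau>\<close>, while the quadratic term can just absorb the linear term
    \<open>\<tau> *\<^sub>R u\<close>.\<close>
  define \<delta> where "\<delta> = \<tau>\<^sup>2"
  have \<delta>: "0 < \<delta>" using \<tau> by (simp add: \<delta>_def)
  define k0 where "k0 z = \<tau> * blinfun_apply u z + blinfun_apply (- y') z + \<delta> / 2 * (norm (z - x))\<^sup>2" for z
  have "\<exists>s. f s + ereal (k0 s) \<noteq> \<infinity> \<and>
      (\<forall>z. f s + ereal (k0 s) \<le> f z + ereal (k0 z) + ereal (\<delta> * dist s z))"
  proof (rule Ekeland_variational_principle)
    show "lsc_fun (\<lambda>z. f z + ereal (k0 z))"
      unfolding k0_def by (intro lsc_fun_add_continuous f continuous_intros)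
    show "f x0 + ereal (k0 x0) \<noteq> \<infinity>" using f_eq[OF x0] by simp
    \<comment> \<open>Fenchel-Young gives \<open>f - y' \<ge> - a\<close>, and completing the square
      absorbs the linear term in \<open>u\<close>.\<close>
    show "ereal (\<tau> * blinfun_apply u x - a - (norm u)\<^sup>2 / 2) \<le> f z + ereal (k0 z)" for z
    proof (cases "z \<in> D")
      case True
      have "- (norm u * norm (z - x)) \<le> blinfun_apply u (z - x)"
        using norm_blinfun[of u "z - x"] by simp
      then have "- (\<tau> * (norm u * norm (z - x))) \<le> \<tau> * blinfun_apply u (z - x)"
        using \<tau> by (metis mult_le_cancel_left_pos mult_minus_right)
      moreover have "0 \<le> (\<tau> * norm (z - x) - norm u)\<^sup>2" by simp
      ultimately have "- (norm u)\<^sup>2 / 2 \<le> \<tau> * blinfun_apply u (z - x) + \<delta> / 2 * (norm (z - x))\<^sup>2"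
        by (simp add: \<delta>_def power2_eq_square algebra_simps)
      then show ?thesis
        using h_ge[OF True] f_eq[OF True]
        by (simp add: k0_def blinfun.diff_right blinfun.minus_left algebra_simps)
    qed (simp add: D_def)
  qed (rule \<delta>)
  then obtain s where s_fin: "f s + ereal (k0 s) \<noteq> \<infinity>"
    and s_min: "\<And>z. f s + ereal (k0 s) \<le> f z + ereal (k0 z) + ereal (\<delta> * dist s z)"
    by blast
  from s_fin have s: "s \<in> D" by (auto simp: D_def)
  \<comment> \<open>With Ekeland's penalty included in \<open>k\<close>, the point \<open>s\<close>
    is an exact minimiser of \<open>f + k\<close>, so the convex sum rule applies.\<close>
  define k where "k z = k0 z + \<delta> * dist s z" for z
  have "convex_on UNIV k"
    unfolding k_def k0_def using \<tau> \<delta>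
    by (intro convex_on_add convex_on_cmul convex_on_blinfun_apply convex_on_norm_diff_power2 convex_on_dist) auto
  moreover have "isCont k s"
    unfolding k_def k0_def by (intro continuous_intros)
  moreover have "h s + k s \<le> h z + k z" if "z \<in> D" for z
    using s_min[of z] f_eq[OF s] f_eq[OF that] by (simp add: k_def)
  ultimately obtain q :: "'a \<Rightarrow>\<^sub>L real" where q: "\<And>z. z \<in> D \<Longrightarrow> h s + q (z - s) \<le> h z"
    and qk: "\<And>z. k s \<le> k z + q (z - s)"
    using convex_sum_rule_at_minimum[OF h_convex s, of k] by blast
  have "ereal (h s + q (z - s)) \<le> f z" for z
    using q[of z] f_eq[of z] by (cases "z \<in> D") (simp, simp add: D_def)
  then have graph: "(s, q) \<in> subdiff_graph f"
    using f_eq[OF s] by (intro subdiff_graphI)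
  \<comment> \<open>The linear part of \<open>k\<close> is \<open>\<tau> *\<^sub>R u - y'\<close>,
    so \<open>- w\<close> is a subgradient at \<open>s\<close> of the norm terms alone.\<close>
  define w where "w = q - y' + \<tau> *\<^sub>R u"
  define \<alpha> where "\<alpha> = norm (s - x)"
  have w_bound: "blinfun_apply w (s - x) + blinfun_apply (- w) v
      \<le> \<delta> / 2 * ((norm v)\<^sup>2 - \<alpha>\<^sup>2) + \<delta> * (norm v + \<alpha>)" for v
  proof -
    have "\<delta> * dist s (x + v) \<le> \<delta> * (norm v + \<alpha>)"
      using \<delta> norm_triangle_ineq4[of "s - x" v]
      by (intro mult_left_mono) (simp_all add: dist_norm \<alpha>_def algebra_simps)
    then show ?thesis
      using qk[of "x + v"]
      by (simp add: k_def k0_def w_def \<alpha>_def blinfun.bilinear_simps algebra_simps)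
  qed
  \<comment> \<open>Completing the square removes \<open>\<alpha>\<close>, so the distance from
    \<open>s\<close> to \<open>x\<close> needs no bound.\<close>
  have sq: "\<delta> * \<alpha> - \<delta> / 2 * \<alpha>\<^sup>2 \<le> \<delta> / 2"
  proof -
    have "0 \<le> \<delta> / 2 * (\<alpha> - 1)\<^sup>2" using \<delta> by simp
    then show ?thesis by (simp add: power2_eq_square algebra_simps)
  qed
  have wa: "blinfun_apply w (s - x) \<le> \<delta> / 2"
    using w_bound[of 0] sq by (simp add: blinfun.zero_right algebra_simps)
  have \<rho>: "0 \<le> \<rho>" by (simp add: \<rho>_def)
  \<comment> \<open>Taking \<open>v\<close> over the whole ball of radius \<open>\<rho>\<close>
    produces the norm of \<open>w\<close>, which controls its pairing with \<open>x - y''\<close>;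
    thus \<open>y''\<close> is never approximated by elements of the space.\<close>
  have "norm (- w) * \<rho> \<le> \<delta> / 2 * (\<rho> + 1)\<^sup>2 - blinfun_apply w (s - x)"
  proof (rule norm_blinfun_mult_le[OF \<rho>])
    fix v :: 'a assume v: "norm v \<le> \<rho>"
    then have "\<delta> / 2 * (norm v)\<^sup>2 \<le> \<delta> / 2 * \<rho>\<^sup>2" "\<delta> * norm v \<le> \<delta> * \<rho>"
      using \<delta> by (auto intro: power_mono)
    then show "blinfun_apply (- w) v \<le> \<delta> / 2 * (\<rho> + 1)\<^sup>2 - blinfun_apply w (s - x)"
      using w_bound[of v] sq by (simp add: power2_eq_square algebra_simps)
  qed
  moreover have "blinfun_apply w x - blinfun_apply y'' w \<le> norm w * \<rho>"
    using norm_blinfun[of w x] norm_blinfun[of y'' w] by (simp add: \<rho>_def algebra_simps)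
  ultimately have w\<xi>: "blinfun_apply w (s - x) - (blinfun_apply y'' w - blinfun_apply w x) \<le> \<delta> / 2 * (\<rho> + 1)\<^sup>2"
    by simp
  txt \<open>Both \<open>s\<close> (at \<open>q\<close>) and \<open>y''\<close> (at \<open>y'\<close>) are subgradients of \<open>fconj f\<close>, so monotonicity applies.\<close>
  have "blinfun_apply y'' (q - y') \<le> blinfun_apply (q - y') s"
  proof -
    from subdiff_graph_finite[OF f(1) graph] obtain r r' where
      r: "f s = ereal r" "fconj f q = ereal r'" "r + r' = blinfun_apply q s" by blast
    have "blinfun_apply y'' q \<le> r' + b"
      using fenchel_young[of "fconj f" q y''] r b by simp
    then show ?thesis
      using h_ge[OF s] f_eq[OF s] r ab by (simp add: blinfun.diff_right blinfun.diff_left)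
  qed
  \<comment> \<open>In the monotonicity inequality the summand \<open>- \<tau> *\<^sub>R u\<close>
    yields the wanted pairing with \<open>s - x\<close>, and \<open>w\<close> the error already
    bounded.\<close>
  moreover have "q - y' = w - \<tau> *\<^sub>R u" by (simp add: w_def)
  ultimately have "\<tau> * blinfun_apply u (s - x) \<le> \<tau> * c
      + (blinfun_apply w (s - x) - (blinfun_apply y'' w - blinfun_apply w x))"
    by (simp add: c_def blinfun.bilinear_simps algebra_simps)
  also have "\<dots> \<le> \<tau> * (c + \<tau> / 2 * (\<rho> + 1)\<^sup>2)"
    using w\<xi> by (simp add: \<delta>_def power2_eq_square algebra_simps)
  finally have ua: "blinfun_apply u (s - x) \<le> c + \<tau> / 2 * (\<rho> + 1)\<^sup>2"
    using \<tau> by simp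
  have "q - x' = w + (1 - \<tau>) *\<^sub>R u" by (simp add: w_def u_def algebra_simps)
  then have "blinfun_apply (q - x') (s - x) = blinfun_apply w (s - x) + (1 - \<tau>) * blinfun_apply u (s - x)"
    by (simp add: blinfun.add_left blinfun.scaleR_left)
  also have "\<dots> \<le> \<delta> / 2 + (1 - \<tau>) * (c + \<tau> / 2 * (\<rho> + 1)\<^sup>2)"
    using wa ua \<tau> by (intro add_mono mult_left_mono) auto
  \<comment> \<open>The three summands of \<open>M\<close> absorb, in order,
    \<open>- \<tau> * c\<close>, the error in \<open>(\<rho> + 1)\<^sup>2\<close> and
    \<open>\<delta> / 2\<close>.\<close>
  also have "\<dots> \<le> c + \<tau> * M"
  proof -
    have "\<delta> / 2 \<le> \<tau>" using \<tau> by (simp add: \<delta>_def power2_eq_square mult_le_cancel_left2)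
    moreover have "- (\<tau> * c) \<le> \<tau> * \<bar>c\<bar>"
      using \<tau> by (metis abs_ge_minus_self mult_le_cancel_left_pos mult_minus_right)
    moreover have "(1 - \<tau>) * (\<tau> / 2 * (\<rho> + 1)\<^sup>2) \<le> 1 * (\<tau> * (\<rho> + 1)\<^sup>2)"
      using \<tau> by (intro mult_mono mult_right_mono) auto
    moreover have "(1 - \<tau>) * (c + \<tau> / 2 * (\<rho> + 1)\<^sup>2) = c - \<tau> * c + (1 - \<tau>) * (\<tau> / 2 * (\<rho> + 1)\<^sup>2)"
      by (simp add: algebra_simps)
    moreover have "\<tau> * M = \<tau> * \<bar>c\<bar> + \<tau> * (\<rho> + 1)\<^sup>2 + \<tau>"
      by (simp add: M_def distrib_left)
    ultimately show ?thesis by linarith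
  qed
  also have "\<dots> \<le> c + e" using \<tau> by simp
  finally show ?thesis using graph by (auto simp: c_def u_def)
qed

section \<open>Passage from the conjugate inequalities to the graphs\<close>

theorem theorem3p7:
  fixes f :: "'a::banach \<Rightarrow> ereal"
  assumes "\<exists>x::'a. x \<noteq> 0"
    and "proper_fun f" and "convex_fun f" and "lsc_fun f"
  shows "\<forall>y' y''. (y', y'') \<in> fitz_ext_graph (subdiff_graph f) \<longleftrightarrow>
                  fconj f y' + fconj (fconj f) y'' = ereal (blinfun_apply y'' y')"
proof (intro allI iffI)
  fix y' y''
  let ?G = "subdiff_graph f"
  have young: "ereal (blinfun_apply y'' y') \<le> fconj f y' + fconj (fconj f) y''"
    using fenchel_young[of "fconj f" y' y''] fconj_neq_MInf[OF assms(2)] by blast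
  {
    assume "(y', y'') \<in> fitz_ext_graph ?G"
    then have eq: "fitz_conj ?G y' y'' = ereal (blinfun_apply y'' y')"
      by (simp add: fitz_ext_graph_def)
    \<comment> \<open>Over an empty graph the Fitzpatrick function is \<open>-\<infinity>\<close>
      and its conjugate \<open>\<infinity>\<close>, which the real value in \<open>eq\<close>
      excludes.\<close>
    have "?G \<noteq> {}"
    proof
      assume "?G = {}"
      then have "fitz_conj ?G y' y'' = \<infinity>"
        by (simp add: fitz_conj_def fitz_fun_def bot_ereal_def)
      with eq show False by simp
    qed
    then show "fconj f y' + fconj (fconj f) y'' = ereal (blinfun_apply y'' y')"
      using fconj_add_le_fitz_conj[OF assms(2), of y' y''] young eq by simp
  next
    assume eq: "fconj f y' + fconj (fconj f) y'' = ereal (blinfun_apply y'' y')"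
    note near = subdiff_graph_near_bidual_subgradient[OF assms(2-4) eq]
    have "?G \<noteq> {}" using near[of 1] by auto
    then have "ereal (blinfun_apply y'' y') \<le> fitz_conj ?G y' y''"
      using fconj_add_le_fitz_conj[OF assms(2), of y' y''] eq by simp
    moreover have "fitz_conj ?G y' y'' \<le> ereal (blinfun_apply y'' y')"
      unfolding fitz_conj_def
    proof (rule SUP_least)
      fix p :: "'a \<times> ('a \<Rightarrow>\<^sub>L real)"
      obtain x x' where p: "p = (x, x')" by (cases p)
      have "ereal (blinfun_apply y' x + blinfun_apply y'' x' - blinfun_apply y'' y') \<le> fitz_fun ?G x x' + ereal e"
        if "0 < e" for e
      proof -
        from near[OF that, of x' x] obtain s s' where s: "(s, s') \<in> ?G"
          and le: "blinfun_apply (s' - x') (s - x) \<le> blinfun_apply y'' (y' - x') - blinfun_apply (y' - x') x + e"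
          by blast
        have "ereal (blinfun_apply x' s + blinfun_apply s' x - blinfun_apply s' s) \<le> fitz_fun ?G x x'"
          unfolding fitz_fun_def
          using SUP_upper[OF s, of "\<lambda>p. ereal (blinfun_apply x' (fst p) + blinfun_apply (snd p) x
            - blinfun_apply (snd p) (fst p))"] by simp
        \<comment> \<open>Expanding both pairings in \<open>le\<close> cancels the pairing of
          \<open>x\<close> with \<open>x'\<close>; what remains is the Fitzpatrick summand at
          \<open>(s, s')\<close>, up to \<open>e\<close>.\<close>
        then show ?thesis
          using le by (cases "fitz_fun ?G x x'") (auto simp: blinfun.bilinear_simps)
      qed
      then have "ereal (blinfun_apply y' x + blinfun_apply y'' x' - blinfun_apply y'' y') \<le> fitz_fun ?G x x'"
        by (rule_tac ereal_le_epsilon2) blast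
      then show "ereal (blinfun_apply y' (fst p) + blinfun_apply y'' (snd p)) - fitz_fun ?G (fst p) (snd p)
          \<le> ereal (blinfun_apply y'' y')"
        using p by (cases "fitz_fun ?G x x'") auto
    qed
    ultimately show "(y', y'') \<in> fitz_ext_graph ?G"
      by (simp add: fitz_ext_graph_def)
  }
qed

end
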